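(* For every graph $G$, $\mathsf{tree}\text{-}\alpha(G)\le \mathrm{tw}(G)+1$, and this bound is sharp: for every positive integer $k\neq 2$, there exists a graph $G$ such that $\mathsf{tree}\text{-}\alpha(G)=k$ and $\mathrm{tw}(G)=k-1$.
   Context: All graphs are finite, simple, and undirected. A tree decomposition of a graph $G$ is a pair $\mathcal{T}=(T,\{X_t\}_{t\in V(T)})$ where $T$ is a tree and each node $t$ is assigned a bag $X_t\subseteq V(G)$ such that every vertex of $G$ is in at least one bag, every edge of $G$ has both endpoints in some common bag, and for every $u\in V(G)$ the subgraph of $T$ induced by $\{t: u\in X_t\}$ is connected. Its width is $\max_t|X_t|-1$, and the treewidth $\mathrm{tw}(G)$ is the minimum width of a tree decomposition of $G$. The independence number of $\mathcal{T}$ is $\alpha(\mathcal{T})=\max_{t\in V(T)}\alpha(G[X_t])$, where $\alpha(H)$ is the maximum size of an independent set in $H$. The tree-independence number $\mathsf{tree}\text{-}\alpha(G)$ is the minimum of $\alpha(\mathcal{T})$ over all tree decompositions $\mathcal{T}$ of $G$. *)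

theory Defs
  imports "Graph_Theory.Digraph_Component"
begin

text \<open>Finite simple undirected graphs are represented as in \<^theory>\<open>Graph_Theory.Digraph\<close>:
  the locale predicate \<open>graph\<close> describes finite, symmetric, loop-free digraphs without parallel
  arcs, an undirected edge being a pair of opposite arcs.\<close>

definition independent_set :: "('a, 'b) pre_digraph \<Rightarrow> 'a set \<Rightarrow> bool" where
  "independent_set G S \<longleftrightarrow> S \<subseteq> verts G \<and> (\<forall>u\<in>S. \<forall>v\<in>S. \<not> u \<rightarrow>\<^bsub>G\<^esub> v)"

definition independence_number :: "('a, 'b) pre_digraph \<Rightarrow> nat" where
  "independence_number G = Max (card ` {S. independent_set G S})"

text \<open>The constant \<open>Digraph_Component.tree\<close> cannot be used here: it forbids all directed cycles, and
  in a symmetric digraph each pair of opposite arcs is a directed cycle of length 2. The cycles of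
  the underlying undirected simple graph are the directed cycles of length at least 3. Note that
  \<open>Digraph_Component.connected\<close> includes non-emptiness.\<close>

definition undirected_tree :: "('t, 'e) pre_digraph \<Rightarrow> bool" where
  "undirected_tree T \<longleftrightarrow> graph T \<and> Digraph_Component.connected T \<and>
     \<not> (\<exists>p. pre_digraph.cycle T p \<and> 3 \<le> length p)"

definition tree_decomposition ::
  "('a, 'b) pre_digraph \<Rightarrow> ('t, 'e) pre_digraph \<Rightarrow> ('t \<Rightarrow> 'a set) \<Rightarrow> bool" where
  "tree_decomposition G T X \<longleftrightarrow> undirected_tree T \<and>
     (\<forall>t\<in>verts T. X t \<subseteq> verts G) \<and>
     (\<forall>u\<in>verts G. \<exists>t\<in>verts T. u \<in> X t) \<and>
     (\<forall>e\<in>arcs G. \<exists>t\<in>verts T. tail G e \<in> X t \<and> head G e \<in> X t) \<and>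
     (\<forall>u\<in>verts G. Digraph_Component.connected (T \<restriction> {t \<in> verts T. u \<in> X t}))"

text \<open>The width is an integer because the null graph has width \<open>-1\<close>.\<close>

definition td_width :: "('t, 'e) pre_digraph \<Rightarrow> ('t \<Rightarrow> 'a set) \<Rightarrow> int" where
  "td_width T X = int (Max ((\<lambda>t. card (X t)) ` verts T)) - 1"

definition td_independence_number ::
  "('a, 'b) pre_digraph \<Rightarrow> ('t, 'e) pre_digraph \<Rightarrow> ('t \<Rightarrow> 'a set) \<Rightarrow> nat" where
  "td_independence_number G T X = Max ((\<lambda>t. independence_number (G \<restriction> X t)) ` verts T)"

text \<open>Every finite tree is isomorphic to one whose nodes are natural numbers and whose arcs are
  pairs of nodes, so it suffices to minimise over decompositions with such trees.\<close>

definition treewidth :: "('a, 'b) pre_digraph \<Rightarrow> int" where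
  "treewidth G = (LEAST w. \<exists>(T :: (nat, nat \<times> nat) pre_digraph) X.
     tree_decomposition G T X \<and> w = td_width T X)"

definition tree_independence_number :: "('a, 'b) pre_digraph \<Rightarrow> nat" where
  "tree_independence_number G = (LEAST a. \<exists>(T :: (nat, nat \<times> nat) pre_digraph) X.
     tree_decomposition G T X \<and> a = td_independence_number G T X)"

end

theory Submission
  imports Defs "HOL-Library.Nat_Bijection"
begin

text \<open>Bounding the independence number of each bag by its size gives the inequality. For sharpness,
  replace every edge of the complete graph on \<open>k\<close> branch vertices by \<open>k\<close> parallel paths of length
  two. Given a tree decomposition, if two branch vertices share no bag, then the \<open>k\<close> middle vertices
  between them all lie in any bag on the path that separates their two subtrees; otherwise all branch
  vertices share a bag by the Helly property of subtrees. Either way some bag contains \<open>k\<close> independent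
  vertices. Conversely, the bag of all branch vertices together with a bag of size three for each
  middle vertex forms a star decomposition of width \<open>k - 1\<close>. The facts about subtrees are proved by
  repeatedly removing a leaf.\<close>

section \<open>Subtrees of a forest\<close>

text \<open>Connectedness is phrased through cuts rather than walks because a cut is easy to adapt
  when a leaf is deleted. Nonemptiness matches the convention of
  \<open>Digraph_Component.connected\<close>.\<close>

definition cut_connected :: "('t \<times> 't) set \<Rightarrow> 't set \<Rightarrow> bool" where
  "cut_connected r S \<longleftrightarrow> S \<noteq> {} \<and>
     (\<forall>A\<subseteq>S. A \<noteq> {} \<and> A \<noteq> S \<longrightarrow> (\<exists>u\<in>A. \<exists>v\<in>S - A. (u, v) \<in> r))"

lemma cut_connectedD:
  assumes "cut_connected r S" "A \<subseteq> S" "A \<noteq> {}" "A \<noteq> S"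
  obtains u v where "u \<in> A" "v \<in> S" "v \<notin> A" "(u, v) \<in> r"
  using assms unfolding cut_connected_def by blast

section \<open>Connectedness of induced subgraphs through cuts\<close>

lemma symmetric_induce_subgraph:
  assumes "symmetric G" shows "symmetric (G \<restriction> S)"
  unfolding symmetric_def
proof (rule symI)
  fix u v assume uv: "(u, v) \<in> arcs_ends (G \<restriction> S)"
  then have S: "u \<in> S" "v \<in> S" by (auto simp: arcs_ends_conv)
  from uv have "(u, v) \<in> arcs_ends G" by (auto simp: arcs_ends_conv)
  with assms have "(v, u) \<in> arcs_ends G" by (auto simp: symmetric_def dest: symD)
  with S show "(v, u) \<in> arcs_ends (G \<restriction> S)" by (force simp: arcs_ends_conv)
qed

text \<open>A set that no edge leaves contains everything reachable from it; conversely, the set of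
  nodes reachable from a fixed node is never left by an edge, so it is all of
  \<open>S\<close>.\<close>

lemma connected_induce_subgraph_iff:
  assumes "wf_digraph T" "symmetric T"
  shows "Digraph_Component.connected (T \<restriction> S) \<longleftrightarrow> cut_connected (arcs_ends T) S"
proof -
  interpret T: wf_digraph T by fact
  interpret TS: wf_digraph "T \<restriction> S" by (rule T.wellformed_induce_subgraph)
  have sym: "symmetric (T \<restriction> S)" using assms(2) by (rule symmetric_induce_subgraph)
  have step: "(u, v) \<in> arcs_ends (T \<restriction> S) \<longleftrightarrow> (u, v) \<in> arcs_ends T \<and> u \<in> S \<and> v \<in> S" for u v
    by (force simp: arcs_ends_conv)
  have "Digraph_Component.connected (T \<restriction> S) \<longleftrightarrow>
      S \<noteq> {} \<and> (\<forall>u\<in>S. \<forall>v\<in>S. u \<rightarrow>\<^sup>*\<^bsub>T \<restriction> S\<^esub> v)"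
    unfolding connected_def strongly_connected_def TS.reachable_mk_symmetric_eq[OF sym]
    by simp
  also have "\<dots> \<longleftrightarrow> cut_connected (arcs_ends T) S"
  proof (intro iffI conjI ballI)
    assume asm: "S \<noteq> {} \<and> (\<forall>u\<in>S. \<forall>v\<in>S. u \<rightarrow>\<^sup>*\<^bsub>T \<restriction> S\<^esub> v)"
    have "\<exists>u\<in>A. \<exists>v\<in>S - A. (u, v) \<in> arcs_ends T" if A: "A \<subseteq> S" "A \<noteq> {}" "A \<noteq> S" for A
    proof (rule ccontr)
      assume closed: "\<not> ?thesis"
      obtain a b where ab: "a \<in> A" "b \<in> S" "b \<notin> A" using A by blast
      with asm A have "a \<rightarrow>\<^sup>*\<^bsub>T \<restriction> S\<^esub> b" by blast
      then have "a \<in> A \<longrightarrow> b \<in> A"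
        by (induct rule: TS.reachable_induct) (use closed step in blast)+
      with ab show False by blast
    qed
    with asm show "cut_connected (arcs_ends T) S" unfolding cut_connected_def by blast
  next
    assume conn: "cut_connected (arcs_ends T) S"
    then show "S \<noteq> {}" by (simp add: cut_connected_def)
    fix u v assume uv: "u \<in> S" "v \<in> S"
    define A where "A = {w \<in> S. u \<rightarrow>\<^sup>*\<^bsub>T \<restriction> S\<^esub> w}"
    have "A = S"
    proof (rule ccontr)
      assume "A \<noteq> S"
      moreover have "A \<subseteq> S" "A \<noteq> {}" using uv by (auto simp: A_def)
      ultimately obtain x y where xy: "x \<in> A" "y \<in> S" "y \<notin> A" "(x, y) \<in> arcs_ends T"
        using cut_connectedD[OF conn] by metis
      then have "x \<rightarrow>\<^bsub>T \<restriction> S\<^esub> y" using step by (auto simp: A_def)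
      with xy have "u \<rightarrow>\<^sup>*\<^bsub>T \<restriction> S\<^esub> y" unfolding A_def by (auto intro: TS.reachable_adj_trans)
      with xy show False by (simp add: A_def)
    qed
    with uv show "u \<rightarrow>\<^sup>*\<^bsub>T \<restriction> S\<^esub> v" unfolding A_def by blast
  qed
  finally show ?thesis .
qed

text \<open>Neighbours are counted inside \<open>U\<close> only and isolated nodes qualify, so that
  every nonempty node set of a tree, connected or not, has a leaf. The Helly-type lemmas assume
  exactly this as their notion of forest.\<close>

definition leaf_in :: "('t \<times> 't) set \<Rightarrow> 't set \<Rightarrow> 't \<Rightarrow> bool" where
  "leaf_in r U l \<longleftrightarrow> l \<in> U \<and> (\<forall>x\<in>U. \<forall>y\<in>U. (l, x) \<in> r \<and> (l, y) \<in> r \<longrightarrow> x = y)"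

lemma leaf_neighbour:
  assumes "cut_connected r S" "l \<in> S" "S \<noteq> {l}"
  obtains p where "p \<in> S" "p \<noteq> l" "(l, p) \<in> r"
  using cut_connectedD[OF assms(1), of "{l}"] assms(2,3) by auto

text \<open>Given a cut of \<open>S - {l}\<close>, put \<open>l\<close> on the side of its only
  neighbour \<open>p\<close>. An edge crossing the enlarged cut cannot use \<open>l\<close>, so it
  already crosses the original one.\<close>

lemma cut_connected_remove_leaf:
  assumes "sym r" "leaf_in r U l" "S \<subseteq> U" "cut_connected r S" "S \<noteq> {l}"
  shows "cut_connected r (S - {l})"
proof (cases "l \<in> S")
  case False
  with assms show ?thesis by simp
next
  case True
  then obtain p where p: "p \<in> S" "p \<noteq> l" "(l, p) \<in> r"
    using leaf_neighbour assms(4,5) by metis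
  have uniq: "x = p" if "x \<in> S" "(l, x) \<in> r \<or> (x, l) \<in> r" for x
    using assms(1-3) p that unfolding leaf_in_def by (blast dest: symD)
  show ?thesis unfolding cut_connected_def
  proof (intro conjI allI impI)
    show "S - {l} \<noteq> {}" using p by blast
  next
    fix A assume A: "A \<subseteq> S - {l}" "A \<noteq> {} \<and> A \<noteq> S - {l}"
    define B where "B = (if p \<in> A then insert l A else A)"
    have "B \<subseteq> S" "B \<noteq> {}" "B \<noteq> S" using A True by (auto simp: B_def)
    then obtain u v where uv: "u \<in> B" "v \<in> S" "v \<notin> B" "(u, v) \<in> r"
      using cut_connectedD[OF assms(4)] by metis
    have "u \<in> S" using uv \<open>B \<subseteq> S\<close> by blast
    have "u \<in> A \<and> v \<in> S - {l} - A"
      using uv uniq[of u] uniq[of v] \<open>u \<in> S\<close> A p by (auto simp: B_def split: if_splits)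
    with uv show "\<exists>u\<in>A. \<exists>v\<in>S - {l} - A. (u, v) \<in> r" by blast
  qed
qed

text \<open>Induction on the forest, deleting a leaf \<open>l\<close>. If some subtree is
  \<open>{l}\<close>, all contain \<open>l\<close>. Otherwise every subtree stays connected, and two
  subtrees that share \<open>l\<close> also share the unique neighbour of \<open>l\<close>, so they
  still meet.\<close>

lemma subtrees_Helly:
  fixes S :: "'i \<Rightarrow> 't set"
  assumes "finite W" "sym r"
    and "\<And>U. U \<subseteq> W \<Longrightarrow> U \<noteq> {} \<Longrightarrow> \<exists>l. leaf_in r U l"
    and "I \<noteq> {}"
    and "\<And>i. i \<in> I \<Longrightarrow> S i \<subseteq> W" "\<And>i. i \<in> I \<Longrightarrow> cut_connected r (S i)"
    and "\<And>i j. i \<in> I \<Longrightarrow> j \<in> I \<Longrightarrow> S i \<inter> S j \<noteq> {}"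
  shows "\<exists>t. \<forall>i\<in>I. t \<in> S i"
  using assms
proof (induction W arbitrary: S rule: finite_psubset_induct)
  case (psubset W)
  note leaves = psubset.prems(2) and sub = psubset.prems(4) and conn = psubset.prems(5)
    and meet = psubset.prems(6)
  have "W \<noteq> {}" using \<open>I \<noteq> {}\<close> sub meet by blast
  then obtain l where l: "leaf_in r W l" using leaves by blast
  then have "l \<in> W" by (simp add: leaf_in_def)
  show ?case
  proof (cases "\<exists>i\<in>I. S i = {l}")
    case True
    then have "\<forall>j\<in>I. l \<in> S j" using meet by fastforce
    then show ?thesis by blast
  next
    case False
    have "\<exists>t. \<forall>i\<in>I. t \<in> S i - {l}"
    proof (rule psubset.IH[of "W - {l}"])
      fix i j assume ij: "i \<in> I" "j \<in> I"
      show "(S i - {l}) \<inter> (S j - {l}) \<noteq> {}"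
      proof
        assume emp: "(S i - {l}) \<inter> (S j - {l}) = {}"
        with meet[OF ij] have "l \<in> S i" "l \<in> S j" by blast+
        then obtain p q where "p \<in> S i" "p \<noteq> l" "(l, p) \<in> r" "q \<in> S j" "q \<noteq> l" "(l, q) \<in> r"
          using leaf_neighbour conn ij False by metis
        then show False using emp l sub[OF ij(1)] sub[OF ij(2)] unfolding leaf_in_def by blast
      qed
    next
      show "\<exists>x. leaf_in r U x" if "U \<subseteq> W - {l}" "U \<noteq> {}" for U using leaves that by blast
      show "cut_connected r (S i - {l})" if "i \<in> I" for i
        using cut_connected_remove_leaf[OF \<open>sym r\<close> l sub conn] that False by blast
    qed (use \<open>l \<in> W\<close> \<open>I \<noteq> {}\<close> \<open>sym r\<close> sub in blast)+
    then show ?thesis by blast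
  qed
qed

text \<open>The same induction. If \<open>A\<close> or \<open>B\<close> is \<open>{l}\<close>, every
  \<open>S i\<close> contains \<open>l\<close>; otherwise all intersections survive the deletion of
  \<open>l\<close>, again through its unique neighbour.\<close>

lemma subtrees_joining_disjoint_subtrees:
  fixes S :: "'i \<Rightarrow> 't set"
  assumes "finite W" "sym r"
    and "\<And>U. U \<subseteq> W \<Longrightarrow> U \<noteq> {} \<Longrightarrow> \<exists>l. leaf_in r U l"
    and "A \<subseteq> W" "B \<subseteq> W" "cut_connected r A" "cut_connected r B" "A \<inter> B = {}"
    and "\<And>i. i \<in> I \<Longrightarrow> S i \<subseteq> W" "\<And>i. i \<in> I \<Longrightarrow> cut_connected r (S i)"
    and "\<And>i. i \<in> I \<Longrightarrow> S i \<inter> A \<noteq> {}" "\<And>i. i \<in> I \<Longrightarrow> S i \<inter> B \<noteq> {}"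
  shows "\<exists>t\<in>W. \<forall>i\<in>I. t \<in> S i"
  using assms
proof (induction W arbitrary: S A B rule: finite_psubset_induct)
  case (psubset W)
  note leaves = psubset.prems(2) and AB = psubset.prems(3-7) and sub = psubset.prems(8)
    and conn = psubset.prems(9) and meet = psubset.prems(10,11)
  have "W \<noteq> {}" using AB by (auto simp: cut_connected_def)
  then obtain l where l: "leaf_in r W l" using leaves by blast
  then have "l \<in> W" by (simp add: leaf_in_def)
  show ?case
  proof (cases "A = {l} \<or> B = {l}")
    case True
    then have "\<forall>j\<in>I. l \<in> S j" using meet by fastforce
    then show ?thesis using \<open>l \<in> W\<close> by blast
  next
    case False
    \<comment> \<open>A one-node \<open>S i\<close> would put \<open>l\<close> into both of the
      disjoint sets \<open>A\<close> and \<open>B\<close>.\<close>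
    have ne: "S i \<noteq> {l}" if "i \<in> I" for i 
    proof
      assume "S i = {l}"
      with meet[OF that] have "l \<in> A" "l \<in> B" by auto
      with AB(5) show False by blast
    qed
    have still_meet: "(S i - {l}) \<inter> (C - {l}) \<noteq> {}"
      if C: "i \<in> I" "C \<subseteq> W" "cut_connected r C" "C \<noteq> {l}" "S i \<inter> C \<noteq> {}" for i C
    proof
      assume emp: "(S i - {l}) \<inter> (C - {l}) = {}"
      with C have "l \<in> S i" "l \<in> C" by blast+
      obtain p where p: "p \<in> S i" "p \<noteq> l" "(l, p) \<in> r"
        using leaf_neighbour[OF conn[OF C(1)] \<open>l \<in> S i\<close> ne[OF C(1)]] .
      obtain q where q: "q \<in> C" "q \<noteq> l" "(l, q) \<in> r"
        using leaf_neighbour[OF C(3) \<open>l \<in> C\<close> C(4)] .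
      show False using p q emp l sub[OF C(1)] C(2) unfolding leaf_in_def by blast
    qed
    have "\<exists>t\<in>W - {l}. \<forall>i\<in>I. t \<in> S i - {l}"
    proof (rule psubset.IH[of "W - {l}" "A - {l}" "B - {l}"])
      show "(S i - {l}) \<inter> (A - {l}) \<noteq> {}" "(S i - {l}) \<inter> (B - {l}) \<noteq> {}" if "i \<in> I" for i
        using still_meet[OF that] meet[OF that] AB False by blast+
      show "\<exists>x. leaf_in r U x" if "U \<subseteq> W - {l}" "U \<noteq> {}" for U using leaves that by blast
      show "cut_connected r (S i - {l})" if "i \<in> I" for i
        using cut_connected_remove_leaf[OF \<open>sym r\<close> l sub conn] that ne by blast
      show "cut_connected r (A - {l})" "cut_connected r (B - {l})"
        using cut_connected_remove_leaf[OF \<open>sym r\<close> l] AB False by blast+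
    qed (use \<open>l \<in> W\<close> \<open>sym r\<close> sub AB in blast)+
    then show ?thesis by blast
  qed
qed

text \<open>The last vertex of a longest path is a leaf: a second neighbour would either prolong the path
  or close a cycle.\<close>

lemma undirected_tree_leaf:
  assumes T: "undirected_tree T" and U: "U \<subseteq> verts T" "U \<noteq> {}"
  shows "\<exists>l. leaf_in (arcs_ends T) U l"
proof -
  interpret T: graph T using T by (simp add: undirected_tree_def)
  have sub: "subgraph (T \<restriction> U) T" using U by (intro T.subgraph_induce_subgraphI)
  interpret H: digraph "T \<restriction> U" by (rule T.digraph_subgraph[OF sub])
  have acyclic: "length p < 3" if "H.cycle p" for p
    using T.subgraph_cycle[OF sub that] T by (force simp: undirected_tree_def)
  define P where "P = (\<lambda>n. \<exists>u p v. H.apath u p v \<and> length p = n)"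
  obtain u0 where "u0 \<in> U" using U by blast
  then have "H.apath u0 [] u0" by (simp add: H.apath_Nil_iff)
  then have "P 0" unfolding P_def by force
  moreover have "n \<le> card U" if "P n" for n
  proof -
    obtain u p v where p: "H.apath u p v" "length p = n" using \<open>P n\<close> unfolding P_def by blast
    then have "set (H.awalk_verts u p) \<subseteq> U" "distinct (H.awalk_verts u p)"
      using H.awalk_verts_in_verts unfolding H.apath_def H.awalk_def by auto
    \<comment> \<open>A path with \<open>n\<close> arcs visits \<open>n + 1\<close> distinct
      vertices, so path lengths are bounded and a longest path exists.\<close>
    then have "Suc n \<le> card U"
      using card_mono[of U "set (H.awalk_verts u p)"] H.finite_verts p(2) distinct_card[of "H.awalk_verts u p"]
      by (simp add: H.length_awalk_verts)
    then show ?thesis by simp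
  qed
  ultimately obtain n where n: "P n" "\<And>m. P m \<Longrightarrow> m \<le> n"
    using GreatestI_nat Greatest_le_nat by metis
  then obtain u p v where p: "H.apath u p v" "length p = n" unfolding P_def by blast
  then have vU: "v \<in> U" using H.awalk_last_in_verts by (force simp: H.apath_def)
  \<comment> \<open>The only possible neighbour is the predecessor of \<open>v\<close> on the path.
    If \<open>p\<close> is empty, the unspecified \<open>last p\<close> is harmless: the argument
    then shows that \<open>v\<close> has no neighbour in \<open>U\<close>.\<close>
  have "x = tail T (last p)" if x: "x \<in> U" "(v, x) \<in> arcs_ends T" for x
  proof -
    obtain e where e: "e \<in> arcs (T \<restriction> U)" "tail T e = v" "head T e = x"
      using x vU by (auto simp: arcs_ends_conv)
    have "x \<in> set (H.awalk_verts u p)"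
    proof (rule ccontr)
      assume "x \<notin> set (H.awalk_verts u p)"
      then have "H.apath u (p @ [e]) x"
        using p e unfolding H.apath_def
        by (auto simp: H.awalk_simps H.awalk_verts_append)
      then have "P (Suc n)" using p unfolding P_def by force
      then show False using n by fastforce
    qed
    then obtain q s where qs: "p = q @ s" "H.awalk u q x" "H.awalk x s v"
      using H.awalk_decomp p unfolding H.apath_def by metis
    have "H.awlast u q = x" "H.awlast x s = v" using qs by (auto simp: H.awalk_def H.awlast_if_cas)
    then have "H.apath x s v" using p qs(1) by (simp add: H.apath_append_iff)
    have closed: "H.awalk x (s @ [e]) x"
      using qs e by (intro H.awalk_appendI[of x s v]) (auto simp: H.awalk_simps)
    have "x = hd (H.awalk_verts x s)" using qs by (cases s) (auto simp: H.awalk_simps)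
    \<comment> \<open>The vertex list of \<open>s\<close> starts with \<open>x\<close>; rotating
      \<open>x\<close> to the end preserves distinctness and gives the form that
      \<open>cycle\<close> demands.\<close>
    then have "distinct (tl (H.awalk_verts x s) @ [x])"
      using \<open>H.apath x s v\<close> unfolding H.apath_def
      by (metis H.awalk_verts_non_Nil distinct.simps(2) distinct1_rotate list.exhaust_sel rotate1.simps(2))
    moreover have "H.awalk_verts x (s @ [e]) = H.awalk_verts x s @ [x]"
      using H.awalk_verts_append[OF closed] e by simp
    ultimately have "H.cycle (s @ [e])"
      using closed unfolding H.cycle_def by (intro exI[of _ x]) simp
    \<comment> \<open>The segment \<open>s\<close> from \<open>x\<close> to \<open>v\<close>, closed
      by \<open>e\<close>, is a cycle of length \<open>length s + 1\<close>, hence below 3. As there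
      are no loops, \<open>s\<close> is a single arc, the last one of \<open>p\<close>.\<close>
    then have "length s < 2" using acyclic by fastforce
    moreover have "s \<noteq> []" using qs e H.no_loops[OF e(1)] by (auto simp: H.awalk_simps)
    ultimately obtain f where "s = [f]" by (cases s) auto
    then show ?thesis using qs by (auto simp: H.awalk_simps)
  qed
  with vU show ?thesis unfolding leaf_in_def by blast
qed


section \<open>The two invariants\<close>

lemma independent_set_card_le:
  assumes "finite (verts G)" "independent_set G S"
  shows "card S \<le> independence_number G"
proof -
  have "{S. independent_set G S} \<subseteq> Pow (verts G)" by (auto simp: independent_set_def)
  then have "finite {S. independent_set G S}" using assms(1) finite_subset by blast
  then show ?thesis using assms(2) unfolding independence_number_def
    by (intro Max_ge finite_imageI) auto
qed

lemma independence_number_le_card: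
  assumes "finite (verts G)"
  shows "independence_number G \<le> card (verts G)"
proof -
  have "{S. independent_set G S} \<subseteq> Pow (verts G)" by (auto simp: independent_set_def)
  then have "finite {S. independent_set G S}" using assms finite_subset by blast
  \<comment> \<open>This makes the family under \<open>Max\<close> nonempty.\<close>
  moreover have "independent_set G {}" by (simp add: independent_set_def)
  moreover have "card S \<le> card (verts G)" if "independent_set G S" for S
    using that assms by (auto simp: independent_set_def intro: card_mono)
  ultimately show ?thesis unfolding independence_number_def by (subst Max_le_iff) auto
qed

lemma tree_decomposition_nodes:
  assumes "tree_decomposition G T X"
  shows "finite (verts T)" "verts T \<noteq> {}"
proof -
  interpret T: graph T using assms by (simp add: tree_decomposition_def undirected_tree_def)
  show "finite (verts T)" by simp
  have "Digraph_Component.connected T"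
    using assms by (simp add: tree_decomposition_def undirected_tree_def)
  then show "verts T \<noteq> {}" by (auto simp: connected_def strongly_connected_def)
qed

lemma td_independence_number_le_width:
  assumes G: "finite (verts G)" and td: "tree_decomposition G T X"
  shows "int (td_independence_number G T X) \<le> td_width T X + 1"
proof -
  note T = tree_decomposition_nodes[OF td]
  have "independence_number (G \<restriction> X t) \<le> Max ((\<lambda>t. card (X t)) ` verts T)" if "t \<in> verts T" for t
  proof -
    have "finite (X t)"
      using td that G unfolding tree_decomposition_def by (meson finite_subset)
    then have "independence_number (G \<restriction> X t) \<le> card (X t)"
      using independence_number_le_card[of "G \<restriction> X t"] by simp
    also have "\<dots> \<le> Max ((\<lambda>t. card (X t)) ` verts T)" using T that by (intro Max_ge) auto
    finally show ?thesis .
  qed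
  then have "td_independence_number G T X \<le> Max ((\<lambda>t. card (X t)) ` verts T)"
    unfolding td_independence_number_def using T by (subst Max_le_iff) auto
  then show ?thesis by (simp add: td_width_def)
qed

section \<open>Minimising over tree decompositions\<close>

lemma tree_independence_number_le:
  fixes T :: "(nat, nat \<times> nat) pre_digraph"
  assumes "tree_decomposition G T X"
  shows "tree_independence_number G \<le> td_independence_number G T X"
  unfolding tree_independence_number_def using assms by (intro Least_le) blast

lemma tree_independence_number_attained:
  fixes T :: "(nat, nat \<times> nat) pre_digraph"
  assumes "tree_decomposition G T X"
  obtains T' :: "(nat, nat \<times> nat) pre_digraph" and X' where
    "tree_decomposition G T' X'" "tree_independence_number G = td_independence_number G T' X'"
proof -
  have "\<exists>a (T :: (nat, nat \<times> nat) pre_digraph) X.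
      tree_decomposition G T X \<and> a = td_independence_number G T X"
    using assms by blast
  from LeastI_ex[OF this] show ?thesis
    unfolding tree_independence_number_def[symmetric] using that by blast
qed

text \<open>\<open>LEAST\<close> over the integers needs a lower bound to be attained. Widths are at
  least -1, so minimising the natural number \<open>nat (w + 1)\<close> yields a minimal
  width.\<close>

lemma treewidth_least:
  fixes T :: "(nat, nat \<times> nat) pre_digraph"
  assumes "tree_decomposition G T X"
  obtains T' :: "(nat, nat \<times> nat) pre_digraph" and X' where
    "tree_decomposition G T' X'" "treewidth G = td_width T' X'" "td_width T' X' \<le> td_width T X"
proof -
  define P where "P = (\<lambda>w. \<exists>(T :: (nat, nat \<times> nat) pre_digraph) X.
    tree_decomposition G T X \<and> w = td_width T X)"
  have low: "- 1 \<le> w" if "P w" for w using that by (auto simp: P_def td_width_def)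
  have P: "P (td_width T X)" using assms unfolding P_def by blast
  then obtain w where w: "P w" "\<And>w'. P w' \<Longrightarrow> nat (w + 1) \<le> nat (w' + 1)"
    using ex_has_least_nat[of P _ "\<lambda>w. nat (w + 1)"] by blast
  then have min: "w \<le> w'" if "P w'" for w' using low[OF that] low[OF w(1)] w(2)[OF that] by linarith
  then have "treewidth G = w"
    unfolding treewidth_def P_def[symmetric] using w(1) by (intro Least_equality)
  with w(1) min[OF P] show ?thesis using that unfolding P_def by blast
qed

section \<open>Star decompositions\<close>

definition relation_graph :: "'a set \<Rightarrow> ('a \<times> 'a) set \<Rightarrow> ('a, 'a \<times> 'a) pre_digraph" where
  "relation_graph V E = \<lparr>verts = V, arcs = E, tail = fst, head = snd\<rparr>"

lemma relation_graph_simps [simp]: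
  "verts (relation_graph V E) = V" "arcs (relation_graph V E) = E"
  "tail (relation_graph V E) = fst" "head (relation_graph V E) = snd"
  "arcs_ends (relation_graph V E) = E"
  by (auto simp: relation_graph_def arcs_ends_conv)

lemma graph_relation_graph:
  assumes "finite V" "E \<subseteq> V \<times> V" "sym E" "irrefl E"
  shows "graph (relation_graph V E)"
proof -
  have "finite E" using assms(1,2) finite_subset by blast
  then show ?thesis
    using assms by unfold_locales
      (auto simp: arc_to_ends_def symmetric_def irrefl_def)
qed

text \<open>The centre is fixed as 0 so that the leaves can be middle vertices themselves, each
  naming its own bag.\<close>

definition star :: "nat set \<Rightarrow> (nat, nat \<times> nat) pre_digraph" where
  "star L = relation_graph (insert 0 L) ({0} \<times> L \<union> L \<times> {0})"

lemma graph_star: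
  assumes "finite L" "0 \<notin> L"
  shows "graph (star L)"
  unfolding star_def using assms
  by (intro graph_relation_graph) (auto simp: sym_def irrefl_def intro: gr0I)

text \<open>A singleton has no proper cut. Once the centre is in \<open>S\<close>, any cut separates
  it from some leaf in \<open>S\<close>, and the edge between them crosses.\<close>

lemma connected_star_induce:
  assumes "finite L" "0 \<notin> L" "S \<subseteq> insert 0 L" "0 \<in> S \<or> (\<exists>s. S = {s})"
  shows "Digraph_Component.connected (star L \<restriction> S)"
proof -
  interpret graph "star L" using assms by (intro graph_star)
  have "\<exists>u\<in>A. \<exists>v\<in>S - A. (u, v) \<in> {0} \<times> L \<union> L \<times> {0}"
    if A: "A \<subseteq> S" "A \<noteq> {}" "A \<noteq> S" for A
  proof -
    have "0 \<in> S" using assms(4) A by blast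
    show ?thesis
    proof (cases "0 \<in> A")
      case True
      obtain v where "v \<in> S - A" using A by blast
      with True assms(3) show ?thesis by auto
    next
      case False
      obtain u where "u \<in> A" using A by blast
      with False assms(3) A \<open>0 \<in> S\<close> show ?thesis by auto
    qed
  qed
  then have "cut_connected (arcs_ends (star L)) S"
    using assms(4) unfolding cut_connected_def by (auto simp: star_def)
  then show ?thesis
    using connected_induce_subgraph_iff[OF wf_digraph sym_arcs] by blast
qed

text \<open>Every edge has the centre as an endpoint, so a closed walk with at least three arcs
  returns to the centre after two steps, too early for a cycle.\<close>

lemma undirected_tree_star:
  assumes "finite L" "0 \<notin> L"
  shows "undirected_tree (star L)"
proof -
  interpret T: graph "star L" using assms by (intro graph_star)
  have "star L \<restriction> insert 0 L = star L"
    by (auto simp: star_def relation_graph_def induce_subgraph_def)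
  then have "Digraph_Component.connected (star L)"
    using connected_star_induce[OF assms, of "insert 0 L"] by simp
  moreover have "length p < 3" if cycle: "T.cycle p" for p
  proof (rule ccontr)
    assume "\<not> length p < 3"
    then obtain a b c q where p: "p = a # b # c # q"
      by (auto simp: not_less numeral_3_eq_3 Suc_le_length_iff)
    obtain u where u: "T.awalk u p u" "distinct (tl (T.awalk_verts u p))"
      using cycle unfolding T.cycle_def by blast
    have arcs: "{a, b, c} \<subseteq> {0} \<times> L \<union> L \<times> {0}" and step: "snd a = fst b" "snd b = fst c" "u = fst a"
      using u(1) by (auto simp: p T.awalk_simps) (auto simp: star_def)
    have q: "T.awalk (snd c) q u" and d: "distinct (fst b # fst c # T.awalk_verts (snd c) q)"
      using u by (auto simp: p T.awalk_simps) (auto simp: star_def)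
    \<comment> \<open>The start \<open>u\<close> counts as the final vertex of \<open>q\<close>. The
      repeated centre is then either \<open>fst b\<close> and \<open>snd c\<close>, or
      \<open>fst c\<close> and \<open>u\<close>.\<close>
    then have ends: "snd c \<in> set (T.awalk_verts (snd c) q)" "u \<in> set (T.awalk_verts (snd c) q)"
      using T.hd_in_awalk_verts(1)[OF q] last_in_set[of "T.awalk_verts (snd c) q"] by auto
    show False
    proof (cases "fst b = 0")
      case True
      with arcs step assms(2) have "snd c = 0" by auto
      with True ends d show False by simp
    next
      case False
      with arcs step have "fst c = 0" "u = 0" by auto
      with ends d show False by simp
    qed
  qed
  ultimately show ?thesis using T.graph_axioms unfolding undirected_tree_def
    by (meson not_less)
qed

text \<open>A single bag shows that the set of widths being minimised is nonempty.\<close>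

lemma trivial_tree_decomposition:
  assumes "wf_digraph G"
  shows "tree_decomposition G (star {}) (\<lambda>_. verts G)"
proof -
  interpret wf_digraph G by fact
  have "{t \<in> verts (star {}). u \<in> verts G} = {0}" if "u \<in> verts G" for u
    using that by (auto simp: star_def)
  then show ?thesis
    using undirected_tree_star[of "{}"] connected_star_induce[of "{}" "{0}"]
    by (auto simp: tree_decomposition_def star_def)
qed

text \<open>It suffices to evaluate the independence number on a decomposition of minimum
  width.\<close>

lemma tree_independence_number_le_treewidth:
  assumes "graph G"
  shows "int (tree_independence_number G) \<le> treewidth G + 1"
proof -
  interpret graph G by fact
  obtain T :: "(nat, nat \<times> nat) pre_digraph" and X where
    td: "tree_decomposition G T X" "treewidth G = td_width T X"
    using treewidth_least[OF trivial_tree_decomposition[OF wf_digraph]] by metis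
  have "int (tree_independence_number G) \<le> int (td_independence_number G T X)"
    using tree_independence_number_le[OF td(1)] by simp
  also have "\<dots> \<le> treewidth G + 1"
    using td_independence_number_le_width[OF finite_verts td(1)] td(2) by simp
  finally show ?thesis .
qed

section \<open>Complete graphs with thickened and subdivided edges\<close>

text \<open>The vertices below \<open>k\<close> are the branch vertices; \<open>middle k i j l\<close> is the inner vertex of the
  \<open>l\<close>-th path of length two between the branch vertices \<open>i < j\<close>.\<close>

definition middle :: "nat \<Rightarrow> nat \<Rightarrow> nat \<Rightarrow> nat \<Rightarrow> nat" where
  "middle k i j l = k + prod_encode (l, prod_encode (i, j))"

text \<open>Pairing makes the numbering injective, while the offset \<open>k\<close> keeps it clear
  of the branch vertices.\<close>

lemma middle_eq_iff [simp]: "middle k i j l = middle k i' j' l' \<longleftrightarrow> i = i' \<and> j = j' \<and> l = l'"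
  by (auto simp: middle_def)

lemma middle_ge [simp]: "k \<le> middle k i j l"
  by (simp add: middle_def)

definition middles :: "nat \<Rightarrow> nat set" where
  "middles k = {middle k i j l | i j l. i < j \<and> j < k \<and> l < k}"

text \<open>Only the orientation from branch to middle vertex is recorded, so bipartiteness becomes
  inclusion in a product; \<open>thick_clique\<close> adds the converse.\<close>

definition spokes :: "nat \<Rightarrow> (nat \<times> nat) set" where
  "spokes k = {(b, middle k i j l) | b i j l. i < j \<and> j < k \<and> l < k \<and> (b = i \<or> b = j)}"

definition thick_clique :: "nat \<Rightarrow> (nat, nat \<times> nat) pre_digraph" where
  "thick_clique k = relation_graph ({..<k} \<union> middles k) (spokes k \<union> (spokes k)\<inverse>)"

section \<open>The thickened clique as a finite bipartite graph\<close>

lemma finite_middles: "finite (middles k)"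
proof -
  have "middles k \<subseteq> (\<lambda>(i, j, l). middle k i j l) ` ({..<k} \<times> {..<k} \<times> {..<k})"
    unfolding middles_def by (auto intro!: image_eqI[of _ _ "(_, _, _)"])
  then show ?thesis by (rule finite_subset) simp
qed

lemma middles_ge: "m \<in> middles k \<Longrightarrow> k \<le> m"
  by (auto simp: middles_def)

lemma spokes_subset: "spokes k \<subseteq> {..<k} \<times> middles k"
  by (auto simp: spokes_def middles_def)

lemma graph_thick_clique: "graph (thick_clique k)"
  unfolding thick_clique_def
proof (rule graph_relation_graph)
  show "irrefl (spokes k \<union> (spokes k)\<inverse>)"
    using spokes_subset[of k] middles_ge[of _ k] unfolding irrefl_def by fastforce
qed (use spokes_subset[of k] in \<open>auto simp: finite_middles sym_def\<close>)

text \<open>Every edge joins a branch vertex to a middle vertex, so neither side of the bipartition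
  spans an edge.\<close>

lemma independent_set_thick_clique_induce:
  assumes "S \<subseteq> Y" "S \<subseteq> {..<k} \<or> S \<subseteq> middles k"
  shows "independent_set (thick_clique k \<restriction> Y) S"
proof -
  have "(u, v) \<notin> spokes k" if "u \<in> S" "v \<in> S" for u v
    using assms(2) that spokes_subset[of k] middles_ge[of _ k] by fastforce
  then have "(u, v) \<notin> arcs_ends (thick_clique k)" if "u \<in> S" "v \<in> S" for u v
    using that by (auto simp: thick_clique_def)
  then show ?thesis
    using assms(1) dominates_induce_subgraphD unfolding independent_set_def by (metis induce_subgraph_verts)
qed

lemma thick_clique_decomposition:
  assumes "0 < k" "k \<noteq> 2"
  obtains T :: "(nat, nat \<times> nat) pre_digraph" and X where
    "tree_decomposition (thick_clique k) T X" "td_width T X \<le> int k - 1"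
proof -
  define X where "X = (\<lambda>t. if t = 0 then {..<k} else insert t {b. (b, t) \<in> spokes k})"
  \<comment> \<open>As \<open>k\<close> is positive, 0 is a branch vertex and is free to name the
    centre of the star.\<close>
  have zero: "0 \<notin> middles k" using middles_ge[of 0 k] assms(1) by auto
  note star = finite_middles[of k] zero
  have X0: "X 0 = {..<k}" by (simp add: X_def)
  have Xm: "X m = insert m {b. (b, m) \<in> spokes k}" if "m \<in> middles k" for m
    using that zero by (auto simp: X_def)
  have nodes: "verts (star (middles k)) = insert 0 (middles k)" by (simp add: star_def)
  have verts: "verts (thick_clique k) = {..<k} \<union> middles k"
    and arcs: "arcs (thick_clique k) = spokes k \<union> (spokes k)\<inverse>"
    and ends: "tail (thick_clique k) = fst" "head (thick_clique k) = snd"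
    by (simp_all add: thick_clique_def)
  have cover: "\<exists>t\<in>insert 0 (middles k). fst e \<in> X t \<and> snd e \<in> X t"
    if "e \<in> spokes k \<union> (spokes k)\<inverse>" for e
    using that spokes_subset[of k] Xm by fastforce
  have conn: "Digraph_Component.connected
      (star (middles k) \<restriction> {t \<in> insert 0 (middles k). u \<in> X t})" if "u \<in> {..<k} \<union> middles k" for u
  proof (rule connected_star_induce[OF star])
    show "0 \<in> {t \<in> insert 0 (middles k). u \<in> X t} \<or> (\<exists>s. {t \<in> insert 0 (middles k). u \<in> X t} = {s})"
    proof (cases "u < k")
      case True
      then show ?thesis by (simp add: X0)
    next
      case False
      \<comment> \<open>A middle vertex lies in its own bag only; a branch vertex lies in the
        central bag, which covers the other case.\<close>
      then have "{t \<in> insert 0 (middles k). u \<in> X t} = {u}"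
        using that spokes_subset[of k] Xm X0 by fastforce
      then show ?thesis by blast
    qed
  qed auto
  have "tree_decomposition (thick_clique k) (star (middles k)) X"
    unfolding tree_decomposition_def verts nodes arcs ends
    using undirected_tree_star[OF star] cover conn
  proof (intro conjI)
    show "\<forall>t\<in>insert 0 (middles k). X t \<subseteq> {..<k} \<union> middles k"
      using X0 Xm spokes_subset[of k] by fastforce
    show "\<forall>u\<in>{..<k} \<union> middles k. \<exists>t\<in>insert 0 (middles k). u \<in> X t"
      using X0 Xm by fastforce
  qed blast+
  moreover have "card (X t) \<le> k" if t: "t \<in> insert 0 (middles k)" for t
  proof (cases "t = 0")
    case False
    then obtain i j l where ijl: "i < j" "j < k" "l < k" "t = middle k i j l"
      using t by (auto simp: middles_def)
    then have "X t = {t, i, j}" using False by (auto simp: X_def spokes_def)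
    then have "card (X t) \<le> 3" by (simp add: card_insert_if)
    \<comment> \<open>Here \<open>k \<noteq> 2\<close> enters: a middle vertex exists only for
      \<open>k\<close> at least 2, hence at least 3, and a bag of three fits.\<close>
    then show ?thesis using ijl assms by linarith
  qed (simp add: X0)
  then have "Max ((\<lambda>t. card (X t)) ` insert 0 (middles k)) \<le> k"
    using finite_middles[of k] by (subst Max_le_iff) auto
  then have "td_width (star (middles k)) X \<le> int k - 1"
    unfolding td_width_def nodes by linarith
  ultimately show ?thesis using that by blast
qed

lemma thick_clique_tree_independence_ge:
  assumes k: "0 < k" and td: "tree_decomposition (thick_clique k) T X"
  shows "k \<le> td_independence_number (thick_clique k) T X"
proof -
  let ?G = "thick_clique k"
  have tree: "undirected_tree T" using td by (simp add: tree_decomposition_def)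
  interpret T: graph T using tree by (simp add: undirected_tree_def)
  define B where "B = (\<lambda>u. {t \<in> verts T. u \<in> X t})"
  have sym: "sym (arcs_ends T)" using T.sym_arcs by (simp add: symmetric_def)
  have leaves: "\<exists>l. leaf_in (arcs_ends T) U l" if "U \<subseteq> verts T" "U \<noteq> {}" for U
    using undirected_tree_leaf[OF tree that] .
  have sub: "B u \<subseteq> verts T" for u by (auto simp: B_def)
  have conn: "cut_connected (arcs_ends T) (B u)" if "u \<in> verts ?G" for u
    using td that connected_induce_subgraph_iff[OF T.wf_digraph T.sym_arcs]
    unfolding tree_decomposition_def B_def by blast
  have branch: "i \<in> verts ?G" if "i < k" for i using that by (simp add: thick_clique_def)
  have mid: "middle k i j l \<in> verts ?G" if "i < j" "j < k" "l < k" for i j l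
    using that by (auto simp: thick_clique_def middles_def)
  have spoke: "B (middle k i j l) \<inter> B b \<noteq> {}" if "i < j" "j < k" "l < k" "b = i \<or> b = j" for i j l b
  proof -
    have "(b, middle k i j l) \<in> arcs ?G" using that by (auto simp: thick_clique_def spokes_def)
    then show ?thesis using td unfolding tree_decomposition_def B_def
      by (fastforce simp: thick_clique_def)
  qed
  \<comment> \<open>Both outcomes of the case distinction below, \<open>k\<close> middle vertices or
    all \<open>k\<close> branch vertices in one bag, finish in this way.\<close>
  have large_bag: ?thesis
    if t: "t \<in> verts T" and S: "S \<subseteq> X t" "card S = k" "S \<subseteq> {..<k} \<or> S \<subseteq> middles k" for t S
  proof -
    have "X t \<subseteq> verts ?G" using td t by (simp add: tree_decomposition_def)
    then have "finite (X t)"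
      by (rule finite_subset) (simp add: thick_clique_def finite_middles)
    then have "k \<le> independence_number (?G \<restriction> X t)"
      using independent_set_card_le[of "?G \<restriction> X t" S] independent_set_thick_clique_induce[OF S(1,3)] S(2)
      by simp
    also have "\<dots> \<le> td_independence_number ?G T X"
      unfolding td_independence_number_def using t by (intro Max_ge) auto
    finally show ?thesis .
  qed
  show ?thesis
  proof (cases "\<exists>i j. i < j \<and> j < k \<and> B i \<inter> B j = {}")
    case True
    then obtain i j where ij: "i < j" "j < k" "B i \<inter> B j = {}" by blast
    \<comment> \<open>Each of these middle vertices is adjacent to \<open>i\<close> and to
      \<open>j\<close>, so its subtree meets both \<open>B i\<close> and \<open>B j\<close>.\<close>
    have "\<exists>t\<in>verts T. \<forall>l\<in>{..<k}. t \<in> B (middle k i j l)"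
    proof (rule subtrees_joining_disjoint_subtrees[OF T.finite_verts sym leaves sub sub _ _ ij(3)])
      show "cut_connected (arcs_ends T) (B i)" "cut_connected (arcs_ends T) (B j)"
        using ij by (intro conn branch; simp)+
      fix l assume "l \<in> {..<k}"
      then have l: "l < k" by simp
      show "cut_connected (arcs_ends T) (B (middle k i j l))" by (rule conn[OF mid[OF ij(1,2) l]])
      show "B (middle k i j l) \<inter> B i \<noteq> {}" "B (middle k i j l) \<inter> B j \<noteq> {}"
        using spoke[OF ij(1,2) l] by blast+
    qed (simp_all add: sub)
    then obtain t where t: "t \<in> verts T" "\<And>l. l < k \<Longrightarrow> middle k i j l \<in> X t"
      by (auto simp: B_def)
    show ?thesis
    proof (rule large_bag[OF t(1)])
      show "card (middle k i j ` {..<k}) = k" by (subst card_image) (auto simp: inj_on_def)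
      show "middle k i j ` {..<k} \<subseteq> {..<k} \<or> middle k i j ` {..<k} \<subseteq> middles k"
        using ij by (auto simp: middles_def)
    qed (use t in auto)
  next
    case False
    have "B i \<inter> B j \<noteq> {}" if "i \<in> {..<k}" "j \<in> {..<k}" for i j
    proof (cases i j rule: linorder_cases)
      case equal
      then show ?thesis using conn[OF branch[of i]] that by (simp add: cut_connected_def)
    qed (use False that in blast)+
    then have "\<exists>t. \<forall>i\<in>{..<k}. t \<in> B i"
      using k by (intro subtrees_Helly[OF T.finite_verts sym leaves _ sub]) (auto intro: conn branch)
    then obtain t where "\<And>i. i < k \<Longrightarrow> t \<in> B i" by blast
    then show ?thesis using k by (intro large_bag[of t "{..<k}"]) (auto simp: B_def)
  qed
qed

text \<open>The chain from \<open>k\<close> to the tree-independence number, to the treewidth plus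
  one, and back to at most \<open>k\<close> forces equality throughout.\<close>

lemma thick_clique_sharp:
  assumes "0 < k" "k \<noteq> 2"
  shows "tree_independence_number (thick_clique k) = k" "treewidth (thick_clique k) = int k - 1"
proof -
  obtain T :: "(nat, nat \<times> nat) pre_digraph" and X where
    td: "tree_decomposition (thick_clique k) T X" "td_width T X \<le> int k - 1"
    using thick_clique_decomposition[OF assms] .
  have "k \<le> tree_independence_number (thick_clique k)"
    using tree_independence_number_attained[OF td(1)] thick_clique_tree_independence_ge[OF assms(1)]
    by metis
  moreover have "treewidth (thick_clique k) \<le> int k - 1"
    using treewidth_least[OF td(1)] td(2) by (metis order_trans)
  moreover note tree_independence_number_le_treewidth[OF graph_thick_clique[of k]]
  ultimately show "tree_independence_number (thick_clique k) = k"
    "treewidth (thick_clique k) = int k - 1" by linarith+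
qed

theorem theorem3p8:
  shows "(\<forall>G :: ('a, 'b) pre_digraph. graph G \<longrightarrow>
            int (tree_independence_number G) \<le> treewidth G + 1) \<and>
         (\<forall>k::nat. 0 < k \<and> k \<noteq> 2 \<longrightarrow>
            (\<exists>G :: (nat, nat \<times> nat) pre_digraph. graph G \<and>
               tree_independence_number G = k \<and> treewidth G = int k - 1))"
  using tree_independence_number_le_treewidth graph_thick_clique thick_clique_sharp by metis

end
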